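(* Let $\lambda>0$ and $R>0$ be real numbers, and let $\varepsilon\in(0,\lambda)$. Then there exist a positive real number $t_0$ with $$t_0\le 16\left(\frac{\pi}{\varepsilon}+1\right)R+\frac{2(\pi+1)}{\varepsilon}+\frac{8}{\lambda}+2+8\log 2,$$ and a $t_0$-periodic function $\delta:[0,+\infty)\to[0,+\infty)$ such that $$|\delta(t)-\delta(s)|\le\varepsilon|t-s|\qquad\forall t\ge 0,\ \forall s\ge 0,$$ $$\delta(t)\ge\lambda-\varepsilon\qquad\forall t\ge 0,$$ and such that every solution $u:[0,+\infty)\to\mathbb{R}$ to $$u''(t)+2\delta(t)u'(t)+\lambda^2u(t)=0$$ satisfies $$|u'(t)|^2+\lambda^2|u(t)|^2\le\left(|u'(0)|^2+\lambda^2|u(0)|^2\right)\exp\left(-R\,(t-t_0)^+\right)\qquad\forall t\ge 0.$$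
   Context: $(x)^+:=\max\{x,0\}$; $\log$ is the natural logarithm. *)

theory Defs
  imports Complex_Main
begin

text \<open>
  \<open>damped_solution \<delta> \<omega> u u'\<close>: the function \<open>u\<close> solves \<open>u'' + 2 \<delta> u' + \<omega>\<^sup>2 u = 0\<close> on
  the half-line, with first derivative \<open>u'\<close>. Derivatives are taken within \<open>{0..}\<close>, so they
  are one-sided at \<open>0\<close>. Values at negative arguments play no role. For continuous \<open>\<delta>\<close>
  the second derivative is automatically continuous, so this is the classical notion.
\<close>

definition damped_solution ::
    "(real \<Rightarrow> real) \<Rightarrow> real \<Rightarrow> (real \<Rightarrow> real) \<Rightarrow> (real \<Rightarrow> real) \<Rightarrow> bool" where
  "damped_solution \<delta> \<omega> u u' \<longleftrightarrow>
     (\<exists>u''. \<forall>t\<ge>0.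
        (u has_real_derivative u' t) (at t within {0..}) \<and>
        (u' has_real_derivative u'' t) (at t within {0..}) \<and>
        u'' t + 2 * \<delta> t * u' t + \<omega>\<^sup>2 * u t = 0)"

end

theory Submission
  imports Defs "HOL-Analysis.Analysis"
begin

text \<open>
  The damping consists of tent-shaped pulses of length \<open>L\<close> separated by rests of length \<open>\<tau>\<close>
  with constant damping \<open>\<omega> - \<epsilon>\<close>. A long pulse destroys the energy of one solution \<open>f\<close>, the
  one whose position vanishes at the end of the overdamped part, but may hardly affect the
  solution \<open>g\<close> with orthogonal initial data. During a rest the phase vector rotates through
  at least half a turn within time \<open>\<pi> / \<epsilon>\<close>, so \<open>\<tau>\<close> can be chosen such that \<open>g\<close> enters the
  next pulse in the direction of the initial data of \<open>f\<close>. Hence after two pulses both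
  components have been destroyed, and the period is \<open>2 (L + \<tau>)\<close>.
\<close>

section \<open>Monotonicity and global Picard-Lindelof on a compact interval\<close>

lemma has_derivative_nonpos_imp_le:
  fixes f f' :: "real \<Rightarrow> real"
  assumes "a \<le> b"
    and d: "\<And>t. t \<in> {a..b} \<Longrightarrow> (f has_real_derivative f' t) (at t within {a..b})"
    and le: "\<And>t. t \<in> {a..b} \<Longrightarrow> f' t \<le> 0"
  shows "f b \<le> f a"
proof (rule DERIV_nonpos_imp_decreasing_open[OF \<open>a \<le> b\<close>])
  fix t assume "a < t" "t < b"
  then show "\<exists>y. (f has_real_derivative y) (at t) \<and> y \<le> 0"
    using d[of t] le[of t] by (auto simp: at_within_Icc_at)
next
  show "continuous_on {a..b} f"
    using d by (meson DERIV_continuous continuous_on_eq_continuous_within)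
qed

text \<open>The Picard increments are bounded by \<open>B * (M * t) ^ n / fact n\<close>, so the
  iterates converge uniformly on all of \<open>{0..T}\<close> at once, with no gluing of short
  intervals. Regularity of \<open>F\<close> in time enters only along continuous curves, which is
  the form the integral equation uses.\<close>

lemma picard_lindelof_Icc:
  fixes F :: "real \<Rightarrow> 'a::banach \<Rightarrow> 'a"
  assumes "0 \<le> T" and "0 \<le> M"
    and lip: "\<And>t x y. t \<in> {0..T} \<Longrightarrow> norm (F t x - F t y) \<le> M * norm (x - y)"
    and cont: "\<And>x. continuous_on {0..T} x \<Longrightarrow> continuous_on {0..T} (\<lambda>t. F t (x t))"
  obtains x where "x 0 = x\<^sub>0"
    and "\<And>t. t \<in> {0..T} \<Longrightarrow> (x has_vector_derivative F t (x t)) (at t within {0..T})"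
proof -
  define X where "X = rec_nat (\<lambda>t. x\<^sub>0) (\<lambda>n x t. x\<^sub>0 + integral {0..t} (\<lambda>s. F s (x s)))"
  have X0: "X 0 t = x\<^sub>0" for t by (simp add: X_def)
  have XS: "X (Suc n) t = x\<^sub>0 + integral {0..t} (\<lambda>s. F s (X n s))" for n t
    by (simp add: X_def)
  have Xc: "continuous_on {0..T} (X n)" for n
  proof (induction n)
    case 0
    show ?case by (simp add: X_def)
  next
    case (Suc n)
    have "(\<lambda>s. F s (X n s)) integrable_on {0..T}"
      using cont[OF Suc] integrable_continuous_interval by blast
    from indefinite_integral_continuous_1[OF this]
    show ?case unfolding XS[abs_def] by (intro continuous_intros)
  qed
  have Fc: "continuous_on {0..t} (\<lambda>s. F s (X n s))" if "t \<in> {0..T}" for n t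
    using continuous_on_subset[OF cont[OF Xc]] that by auto
  have Fi: "(\<lambda>s. F s (X n s)) integrable_on {0..t}" if "t \<in> {0..T}" for n t
    using Fc[OF that] integrable_continuous_interval by blast
  have "continuous_on {0..T} (\<lambda>t. X 1 t - X 0 t)"
    by (intro continuous_intros Xc)
  then have "bounded ((\<lambda>t. X 1 t - X 0 t) ` {0..T})"
    using compact_continuous_image compact_imp_bounded by blast
  then obtain B where B: "\<And>t. t \<in> {0..T} \<Longrightarrow> norm (X 1 t - X 0 t) \<le> B"
    unfolding bounded_iff by (meson imageI)
  have bd: "norm (X (Suc n) t - X n t) \<le> B * (M * t) ^ n / fact n" if "t \<in> {0..T}" for n t
    using that
  proof (induction n arbitrary: t)
    case 0
    then show ?case using B by simp
  next
    case (Suc n)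
    have I: "((\<lambda>s. M * (B * (M * s) ^ n / fact n)) has_integral
        B * (M * t) ^ Suc n / fact (Suc n) - B * (M * 0) ^ Suc n / fact (Suc n)) {0..t}"
    proof (rule fundamental_theorem_of_calculus)
      fix s assume "s \<in> {0..t}"
      show "((\<lambda>s. B * (M * s) ^ Suc n / fact (Suc n)) has_vector_derivative
          M * (B * (M * s) ^ n / fact n)) (at s within {0..t})"
        unfolding has_real_derivative_iff_has_vector_derivative[symmetric]
        by (rule derivative_eq_intros refl | simp)+
    qed (use Suc.prems in auto)
    have "X (Suc (Suc n)) t - X (Suc n) t
        = integral {0..t} (\<lambda>s. F s (X (Suc n) s) - F s (X n s))"
      using integral_diff[OF Fi[OF Suc.prems] Fi[OF Suc.prems], of "Suc n" n]
      by (simp only: XS[of "Suc n" t] XS[of n t] add_diff_cancel_left)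
    also have "norm \<dots> \<le> integral {0..t} (\<lambda>s. M * (B * (M * s) ^ n / fact n))"
    proof (rule integral_norm_bound_integral)
      show "(\<lambda>s. F s (X (Suc n) s) - F s (X n s)) integrable_on {0..t}"
        by (intro integrable_diff Fi Suc.prems)
      show "(\<lambda>s. M * (B * (M * s) ^ n / fact n)) integrable_on {0..t}"
        using I by blast
      fix s assume "s \<in> {0..t}"
      then have s: "s \<in> {0..T}" using Suc.prems by auto
      show "norm (F s (X (Suc n) s) - F s (X n s)) \<le> M * (B * (M * s) ^ n / fact n)"
        using lip[OF s] mult_left_mono[OF Suc.IH[OF s] \<open>0 \<le> M\<close>] by (rule order_trans)
    qed
    also have "\<dots> = B * (M * t) ^ Suc n / fact (Suc n)"
      using integral_unique[OF I] by simp
    finally show ?case .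
  qed
  have "B \<ge> 0" using order_trans[OF norm_ge_zero B[of 0]] \<open>0 \<le> T\<close> by simp
  have bdT: "norm (X (Suc n) t - X n t) \<le> B * ((M * T) ^ n / fact n)" if "t \<in> {0..T}" for n t
  proof -
    have "(M * t) ^ n \<le> (M * T) ^ n"
      using that \<open>0 \<le> M\<close> by (intro power_mono mult_left_mono) auto
    then show ?thesis
      using bd[OF that, of n] \<open>B \<ge> 0\<close>
      by (smt (verit) divide_right_mono fact_ge_zero mult_left_mono times_divide_eq_right)
  qed
  have sm: "summable (\<lambda>n. B * ((M * T) ^ n / fact n))"
    using summable_exp[of "M * T"] by (intro summable_mult) (simp add: field_simps)
  have "uniform_limit {0..T} (\<lambda>n t. \<Sum>i<n. X (Suc i) t - X i t)
      (\<lambda>t. \<Sum>i. X (Suc i) t - X i t) sequentially"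
    by (rule Weierstrass_m_test[OF bdT sm])
  moreover have "(\<Sum>i<n. X (Suc i) t - X i t) = X n t - x\<^sub>0" for n t
    using sum_lessThan_telescope[of "\<lambda>i. X i t" n] by (simp add: X0)
  ultimately obtain y where y: "uniform_limit {0..T} (\<lambda>n t. X n t - x\<^sub>0) y sequentially"
    by auto
  define x where "x = (\<lambda>t. y t + x\<^sub>0)"
  have ul: "uniform_limit {0..T} X x sequentially"
    using uniform_limit_add[OF y uniform_limit_const[where c = "\<lambda>_. x\<^sub>0"]] by (simp add: x_def)
  have xc: "continuous_on {0..T} x"
    by (rule uniform_limit_theorem[OF _ ul]) (auto simp: Xc)
  have Fxc: "continuous_on {0..T} (\<lambda>s. F s (x s))" by (rule cont[OF xc])
  have ulF: "uniform_limit {0..T} (\<lambda>n s. F s (X n s)) (\<lambda>s. F s (x s)) sequentially"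
  proof (rule uniform_limitI)
    fix e :: real assume "e > 0"
    \<comment> \<open>The denominator \<open>M + 1\<close> also covers the case
      \<open>M = 0\<close>.\<close>
    then have "e / (M + 1) > 0" using \<open>0 \<le> M\<close> by simp
    from uniform_limitD[OF ul this]
    show "\<forall>\<^sub>F n in sequentially. \<forall>s\<in>{0..T}. dist (F s (X n s)) (F s (x s)) < e"
    proof (rule eventually_mono, intro ballI)
      fix n s assume a: "\<forall>s\<in>{0..T}. dist (X n s) (x s) < e / (M + 1)" and s: "s \<in> {0..T}"
      have "dist (F s (X n s)) (F s (x s)) \<le> M * dist (X n s) (x s)"
        using lip[OF s] by (simp add: dist_norm)
      also have "\<dots> \<le> M * (e / (M + 1))"
        using a s \<open>0 \<le> M\<close> by (intro mult_left_mono) (auto simp: less_imp_le)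
      also have "\<dots> < e" using \<open>0 \<le> M\<close> \<open>e > 0\<close> by (simp add: field_simps)
      finally show "dist (F s (X n s)) (F s (x s)) < e" .
    qed
  qed
  have eq: "x t = x\<^sub>0 + integral {0..t} (\<lambda>s. F s (x s))" if t: "t \<in> {0..T}" for t
  proof -
    have "uniform_limit {0..t} (\<lambda>n s. F s (X n s)) (\<lambda>s. F s (x s)) sequentially"
      using ulF by (rule uniform_limit_on_subset) (use t in auto)
    then obtain I J where I: "\<And>n. ((\<lambda>s. F s (X n s)) has_integral I n) {0..t}"
      and J: "((\<lambda>s. F s (x s)) has_integral J) {0..t}" and IJ: "I \<longlonglongrightarrow> J"
      by (rule uniform_limit_integral[OF _ Fc[OF t]]) auto
    have "(\<lambda>n. x\<^sub>0 + I n) \<longlonglongrightarrow> x\<^sub>0 + J" by (intro tendsto_intros IJ)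
    moreover have "x\<^sub>0 + I n = X (Suc n) t" for n
      using integral_unique[OF I] by (simp add: XS)
    moreover have "(\<lambda>n. X (Suc n) t) \<longlonglongrightarrow> x t"
      using tendsto_uniform_limitI[OF ul t] LIMSEQ_Suc by blast
    ultimately have "x t = x\<^sub>0 + J" using LIMSEQ_unique by fastforce
    then show ?thesis using integral_unique[OF J] by simp
  qed
  show thesis
  proof (rule that[of x])
    show "x 0 = x\<^sub>0" using eq[of 0] \<open>0 \<le> T\<close> by simp
    fix t assume t: "t \<in> {0..T}"
    have "((\<lambda>t. x\<^sub>0 + integral {0..t} (\<lambda>s. F s (x s))) has_vector_derivative 0 + F t (x t))
        (at t within {0..T})"
      by (intro has_vector_derivative_add has_vector_derivative_const
          integral_has_vector_derivative[OF Fxc t])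
    then show "(x has_vector_derivative F t (x t)) (at t within {0..T})"
      using has_vector_derivative_transform[OF t eq] by simp
  qed
qed

section \<open>The damped equation on a compact interval: energy, time shifts, existence\<close>

text \<open>The first-order system for position and velocity, with one-sided derivatives at both
  ends, so that pulses and rests can be treated one interval at a time.\<close>

definition damped_on ::
    "(real \<Rightarrow> real) \<Rightarrow> real \<Rightarrow> real \<Rightarrow> real \<Rightarrow> (real \<Rightarrow> real) \<Rightarrow> (real \<Rightarrow> real) \<Rightarrow> bool" where
  "damped_on \<delta> \<omega> a b u v \<longleftrightarrow>
     (\<forall>t\<in>{a..b}. (u has_real_derivative v t) (at t within {a..b}) \<and>
        (v has_real_derivative - 2 * \<delta> t * v t - \<omega>\<^sup>2 * u t) (at t within {a..b}))"

text \<open>Twice the mechanical energy at position \<open>p\<close> and velocity \<open>q\<close>.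
  It is a squared Euclidean norm in the coordinates \<open>\<omega> * p\<close> and
  \<open>q\<close>, which gives sense to orthogonality of initial data.\<close>

abbreviation (input) energy :: "real \<Rightarrow> real \<Rightarrow> real \<Rightarrow> real" where
  "energy \<omega> p q \<equiv> q\<^sup>2 + \<omega>\<^sup>2 * p\<^sup>2"

lemma damped_on_subset:
  assumes "damped_on \<delta> \<omega> a b u v" "a \<le> c" "d \<le> b"
  shows "damped_on \<delta> \<omega> c d u v"
proof -
  have "{c..d} \<subseteq> {a..b}" using assms by auto
  then show ?thesis
    using assms(1) unfolding damped_on_def by (meson DERIV_subset subsetD)
qed

lemma damped_on_lincomb:
  assumes "damped_on \<delta> \<omega> a b u v" "damped_on \<delta> \<omega> a b p q"
  shows "damped_on \<delta> \<omega> a b (\<lambda>t. c * u t + d * p t) (\<lambda>t. c * v t + d * q t)"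
  using assms unfolding damped_on_def
  by (auto intro!: derivative_eq_intros simp: algebra_simps)

text \<open>Carries a solution on one pulse to a later pulse, or back to time \<open>0\<close>. With
  \<open>h = 0\<close> it replaces the damping by another one that agrees with it on the
  interval.\<close>

lemma damped_on_shift:
  assumes "damped_on \<delta> \<omega> a b u v" and "\<And>t. t \<in> {a..b} \<Longrightarrow> \<rho> (t + h) = \<delta> t"
  shows "damped_on \<rho> \<omega> (a + h) (b + h) (\<lambda>t. u (t - h)) (\<lambda>t. v (t - h))"
proof -
  have sh: "((\<lambda>t. w (t - h)) has_real_derivative D) (at t within {a + h..b + h})"
    if "(w has_real_derivative D) (at (t - h) within {a..b})" for w D t
  proof -
    have img: "(\<lambda>t. t - h) ` {a + h..b + h} = {a..b}"
      using image_add_atLeastAtMost[of "- h" "a + h" "b + h"] by simp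
    have "(w \<circ> (\<lambda>t. t - h) has_real_derivative D * 1) (at t within {a + h..b + h})"
      by (rule DERIV_image_chain) (use that img in \<open>auto intro!: derivative_eq_intros\<close>)
    then show ?thesis by (simp add: o_def)
  qed
  show ?thesis
    unfolding damped_on_def
  proof (intro ballI conjI)
    fix t assume "t \<in> {a + h..b + h}"
    then have t: "t - h \<in> {a..b}" by auto
    have "\<rho> t = \<delta> (t - h)" using assms(2)[OF t] by simp
    then show "((\<lambda>t. u (t - h)) has_real_derivative v (t - h)) (at t within {a + h..b + h})"
      "((\<lambda>t. v (t - h)) has_real_derivative - 2 * \<rho> t * v (t - h) - \<omega>\<^sup>2 * u (t - h))
        (at t within {a + h..b + h})"
      using assms(1) t by (auto simp: damped_on_def intro!: sh)
  qed
qed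

text \<open>Applied to the difference of two solutions, this also yields uniqueness and the
  comparison of nearby solutions.\<close>

lemma damped_on_energy_le:
  assumes "damped_on \<delta> \<omega> a b u v" "a \<le> b" "\<And>t. t \<in> {a..b} \<Longrightarrow> 0 \<le> \<delta> t"
  shows "energy \<omega> (u b) (v b) \<le> energy \<omega> (u a) (v a)"
proof (rule has_derivative_nonpos_imp_le[OF \<open>a \<le> b\<close>])
  fix t assume t: "t \<in> {a..b}"
  show "((\<lambda>t. energy \<omega> (u t) (v t)) has_real_derivative - 4 * \<delta> t * (v t)\<^sup>2) (at t within {a..b})"
    using assms(1) t unfolding damped_on_def
    by (auto intro!: derivative_eq_intros simp: algebra_simps power2_eq_square)
  show "- 4 * \<delta> t * (v t)\<^sup>2 \<le> 0" using assms(3)[OF t] by simp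
qed

lemma damped_on_exists:
  assumes "0 \<le> T" and \<delta>: "continuous_on {0..T} \<delta>"
  obtains u v where "damped_on \<delta> \<omega> 0 T u v" "u 0 = p" "v 0 = q"
proof -
  have "bounded (\<delta> ` {0..T})"
    using \<delta> compact_continuous_image compact_imp_bounded by blast
  then obtain D where D: "\<And>t. t \<in> {0..T} \<Longrightarrow> \<bar>\<delta> t\<bar> \<le> D"
    unfolding bounded_iff real_norm_def by (meson imageI)
  have "D \<ge> 0" using D[of 0] \<open>0 \<le> T\<close> by auto
  define F where "F = (\<lambda>t z. (snd z, - 2 * \<delta> t * snd z - \<omega>\<^sup>2 * fst z))"
  obtain x where x0: "x 0 = (p, q)"
    and x: "\<And>t. t \<in> {0..T} \<Longrightarrow> (x has_vector_derivative F t (x t)) (at t within {0..T})"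
  proof (rule picard_lindelof_Icc[of T "1 + 2 * D + \<omega>\<^sup>2" F "(p, q)"])
    show "0 \<le> T" by fact
    show "0 \<le> 1 + 2 * D + \<omega>\<^sup>2" using \<open>D \<ge> 0\<close> by simp
    show "continuous_on {0..T} (\<lambda>t. F t (x t))" if "continuous_on {0..T} x" for x
      unfolding F_def by (intro continuous_intros that \<delta>)
    fix t :: real and x y :: "real \<times> real" assume t: "t \<in> {0..T}"
    define z where "z = x - y"
    have "norm (F t x - F t y) = norm (snd z, - 2 * \<delta> t * snd z - \<omega>\<^sup>2 * fst z)"
      by (simp add: F_def z_def algebra_simps)
    also have "\<dots> \<le> \<bar>snd z\<bar> + \<bar>- 2 * \<delta> t * snd z - \<omega>\<^sup>2 * fst z\<bar>"
      using norm_Pair_le[of "snd z" "- 2 * \<delta> t * snd z - \<omega>\<^sup>2 * fst z"] by simp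
    also have "\<dots> \<le> \<bar>snd z\<bar> + (2 * \<bar>\<delta> t\<bar> * \<bar>snd z\<bar> + \<omega>\<^sup>2 * \<bar>fst z\<bar>)"
      using abs_triangle_ineq4[of "- 2 * \<delta> t * snd z" "\<omega>\<^sup>2 * fst z"] by (simp add: abs_mult)
    also have "\<dots> \<le> norm z + (2 * D * norm z + \<omega>\<^sup>2 * norm z)"
      using D[OF t] \<open>D \<ge> 0\<close> norm_fst_le[of "fst z" "snd z"] norm_snd_le[of "snd z" "fst z"]
      by (intro add_mono mult_mono) auto
    finally show "norm (F t x - F t y) \<le> (1 + 2 * D + \<omega>\<^sup>2) * norm (x - y)"
      by (simp add: z_def algebra_simps)
  qed blast
  have "damped_on \<delta> \<omega> 0 T (\<lambda>t. fst (x t)) (\<lambda>t. snd (x t))"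
    unfolding damped_on_def has_real_derivative_iff_has_vector_derivative
    using bounded_linear.has_vector_derivative[OF bounded_linear_fst x]
      bounded_linear.has_vector_derivative[OF bounded_linear_snd x]
    by (auto simp: F_def)
  then show thesis using that x0 by auto
qed

section \<open>Energy loss during an overdamped pulse\<close>

text \<open>Strong damping alone does not suffice, since an overdamped oscillator also has a slow
  mode. The end condition \<open>u b = 0\<close> forces \<open>u\<close> and
  \<open>v + \<omega> * u\<close> to have opposite signs throughout, and then the square of the
  latter decays at rate at least \<open>2 * (2 * c - \<omega>)\<close>. At \<open>b\<close> this
  square is the whole energy.\<close>

lemma damped_on_overdamped_decay:
  assumes "\<omega> > 0" "a \<le> b" and sol: "damped_on \<delta> \<omega> a b u v" and "u b = 0"
    and \<delta>: "continuous_on {a..b} \<delta>"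
    and c: "\<omega> \<le> c" "\<And>t. t \<in> {a..b} \<Longrightarrow> c \<le> \<delta> t"
  shows "energy \<omega> (u b) (v b) \<le> exp (- 2 * (2 * c - \<omega>) * (b - a)) * energy \<omega> (u a) (v a)"
proof -
  \<comment> \<open>At critical damping the equation factors as (d/dt + \<omega>)^2 u = 0, and
    \<open>w\<close> is the inner factor. Hence the coupling term in its derivative carries the
    factor \<open>\<delta> t - \<omega>\<close>.\<close>
  define w where "w t = v t + \<omega> * u t" for t
  define D where "D t = integral {a..t} \<delta>" for t
  have D: "(D has_real_derivative \<delta> t) (at t within {a..b})" if "t \<in> {a..b}" for t
    unfolding D_def by (rule integral_has_real_derivative[OF \<delta> that])
  have u: "(u has_real_derivative w t - \<omega> * u t) (at t within {a..b})" if "t \<in> {a..b}" for t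
    using sol that by (simp add: damped_on_def w_def)
  have w: "(w has_real_derivative
      - (2 * \<delta> t - \<omega>) * w t + 2 * \<omega> * (\<delta> t - \<omega>) * u t) (at t within {a..b})"
    if "t \<in> {a..b}" for t
    using sol that unfolding damped_on_def w_def
    by (auto intro!: derivative_eq_intros simp: algebra_simps power2_eq_square)
  text \<open>The auxiliary function \<open>w\<close> makes \<open>u w exp (2 D)\<close> nondecreasing with value \<open>0\<close> at
    \<open>b\<close>; the resulting sign of \<open>u w\<close> then removes the coupling term from \<open>(w\<^sup>2)'\<close>.\<close>
  have uw: "u t * w t \<le> 0" if t: "t \<in> {a..b}" for t
  proof -
    have "- (u b * w b * exp (2 * D b)) \<le> - (u t * w t * exp (2 * D t))"
    proof (rule has_derivative_nonpos_imp_le[of t b "\<lambda>t. - (u t * w t * exp (2 * D t))"])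
      fix s assume s: "s \<in> {t..b}"
      then have s': "s \<in> {a..b}" using t by auto
      have sub: "{t..b} \<subseteq> {a..b}" using t by auto
      show "((\<lambda>t. - (u t * w t * exp (2 * D t))) has_real_derivative
          - (((w s)\<^sup>2 + 2 * \<omega> * (\<delta> s - \<omega>) * (u s)\<^sup>2) * exp (2 * D s))) (at s within {t..b})"
        using DERIV_subset[OF u[OF s'] sub] DERIV_subset[OF w[OF s'] sub]
          DERIV_subset[OF D[OF s'] sub]
        by (auto intro!: derivative_eq_intros simp: algebra_simps power2_eq_square)
      show "- (((w s)\<^sup>2 + 2 * \<omega> * (\<delta> s - \<omega>) * (u s)\<^sup>2) * exp (2 * D s)) \<le> 0"
        using c(1) c(2)[OF s'] \<open>\<omega> > 0\<close> by simp
    qed (use t in auto)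
    then have "u t * w t * exp (2 * D t) \<le> 0" using \<open>u b = 0\<close> by simp
    then show ?thesis by (simp add: mult_le_0_iff)
  qed
  define k where "k = 2 * (2 * c - \<omega>)"
  have "(w b)\<^sup>2 * exp (k * b) \<le> (w a)\<^sup>2 * exp (k * a)"
  proof (rule has_derivative_nonpos_imp_le[OF \<open>a \<le> b\<close>])
    fix t assume t: "t \<in> {a..b}"
    show "((\<lambda>t. (w t)\<^sup>2 * exp (k * t)) has_real_derivative
        (- 4 * (\<delta> t - c) * (w t)\<^sup>2 + 4 * \<omega> * (\<delta> t - \<omega>) * (u t * w t)) * exp (k * t))
        (at t within {a..b})"
      using w[OF t]
      by (auto intro!: derivative_eq_intros simp: algebra_simps power2_eq_square k_def)
    have "0 \<le> (\<delta> t - c) * (w t)\<^sup>2" using c(2)[OF t] by simp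
    moreover have "\<omega> * (\<delta> t - \<omega>) * (u t * w t) \<le> 0"
      using c(1) c(2)[OF t] \<open>\<omega> > 0\<close> uw[OF t]
      by (intro mult_nonneg_nonpos[OF mult_nonneg_nonneg]) auto
    ultimately show
      "(- 4 * (\<delta> t - c) * (w t)\<^sup>2 + 4 * \<omega> * (\<delta> t - \<omega>) * (u t * w t)) * exp (k * t) \<le> 0"
      by (intro mult_nonpos_nonneg) (auto simp: algebra_simps)
  qed
  then have "(w b)\<^sup>2 \<le> exp (- k * (b - a)) * (w a)\<^sup>2"
    by (simp add: exp_diff exp_minus field_simps)
  \<comment> \<open>The difference of the two sides is -2 \<omega> u v at \<open>a\<close>, and
    opposite signs of \<open>u\<close> and \<open>w\<close> make u v nonpositive.\<close>
  moreover have "(w a)\<^sup>2 \<le> energy \<omega> (u a) (v a)"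
  proof -
    have "energy \<omega> (u a) (v a) - (w a)\<^sup>2 = - (2 * \<omega>) * (u a * w a) + 2 * (\<omega> * u a)\<^sup>2"
      by (simp add: w_def power2_eq_square algebra_simps)
    moreover have "- (2 * \<omega>) * (u a * w a) \<ge> 0"
      using uw[of a] \<open>a \<le> b\<close> \<open>\<omega> > 0\<close> by (intro mult_nonpos_nonpos) auto
    ultimately show ?thesis using zero_le_power2[of "\<omega> * u a"] by linarith
  qed
  ultimately have "(w b)\<^sup>2 \<le> exp (- k * (b - a)) * energy \<omega> (u a) (v a)"
    by (meson exp_ge_zero mult_left_mono order_trans)
  then show ?thesis using \<open>u b = 0\<close> by (simp add: w_def k_def algebra_simps)
qed

text \<open>The solution space is two-dimensional, so some solution of unit initial energy vanishes
  at \<open>b\<close>. It decays fast on \<open>{a..b}\<close>, and its energy cannot grow on the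
  two flanks.\<close>

lemma damped_on_fast_solution:
  assumes "\<omega> > 0" and \<delta>: "continuous_on {0..L} \<delta>" "\<And>t. t \<in> {0..L} \<Longrightarrow> 0 \<le> \<delta> t"
    and ab: "0 \<le> a" "a \<le> b" "b \<le> L" and c: "\<omega> \<le> c" "\<And>t. t \<in> {a..b} \<Longrightarrow> c \<le> \<delta> t"
  obtains f f' where "damped_on \<delta> \<omega> 0 L f f'" "energy \<omega> (f 0) (f' 0) = 1"
    "energy \<omega> (f L) (f' L) \<le> exp (- 2 * (2 * c - \<omega>) * (b - a))"
proof -
  have "0 \<le> L" using ab by simp
  \<comment> \<open>The initial data of \<open>x\<close> and \<open>y\<close> are orthonormal for
    the energy, so a combination with coefficients \<open>p\<close> and \<open>q\<close> starts with
    energy \<open>q\<^sup>2 + p\<^sup>2\<close>.\<close>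
  obtain x x' where x: "damped_on \<delta> \<omega> 0 L x x'" "x 0 = 1 / \<omega>" "x' 0 = 0"
    using damped_on_exists[OF \<open>0 \<le> L\<close> \<delta>(1)] .
  obtain y y' where y: "damped_on \<delta> \<omega> 0 L y y'" "y 0 = 0" "y' 0 = 1"
    using damped_on_exists[OF \<open>0 \<le> L\<close> \<delta>(1)] .
  have "\<exists>p q. p * x b + q * y b = 0 \<and> q\<^sup>2 + p\<^sup>2 = (1 :: real)"
  proof (cases "x b = 0")
    case True
    then show ?thesis by (intro exI[of _ 1] exI[of _ 0]) simp
  next
    case False
    define r where "r = sqrt ((x b)\<^sup>2 + (y b)\<^sup>2)"
    have "r \<noteq> 0" "r\<^sup>2 = (x b)\<^sup>2 + (y b)\<^sup>2"
      using False by (auto simp: r_def sum_power2_eq_zero_iff)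
    then show ?thesis
      by (intro exI[of _ "y b / r"] exI[of _ "- x b / r"])
        (auto simp: power_divide add_divide_distrib[symmetric])
  qed
  then obtain p q where pq: "p * x b + q * y b = 0" "q\<^sup>2 + p\<^sup>2 = 1" by blast
  define f where "f t = p * x t + q * y t" for t
  define f' where "f' t = p * x' t + q * y' t" for t
  have f: "damped_on \<delta> \<omega> 0 L f f'"
    unfolding f_def[abs_def] f'_def[abs_def] by (rule damped_on_lincomb[OF x(1) y(1)])
  have E0: "energy \<omega> (f 0) (f' 0) = 1"
    using pq(2) x y \<open>\<omega> > 0\<close> by (simp add: f_def f'_def power_divide)
  have "energy \<omega> (f L) (f' L) \<le> energy \<omega> (f b) (f' b)"
    by (rule damped_on_energy_le[OF damped_on_subset[OF f]]) (use ab \<delta>(2) in auto)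
  also have "\<dots> \<le> exp (- 2 * (2 * c - \<omega>) * (b - a)) * energy \<omega> (f a) (f' a)"
    by (rule damped_on_overdamped_decay[OF \<open>\<omega> > 0\<close> _ damped_on_subset[OF f]])
      (use ab c pq(1) continuous_on_subset[OF \<delta>(1)] in \<open>auto simp: f_def\<close>)
  also have "\<dots> \<le> exp (- 2 * (2 * c - \<omega>) * (b - a)) * energy \<omega> (f 0) (f' 0)"
    by (intro mult_left_mono damped_on_energy_le[OF damped_on_subset[OF f]])
      (use ab \<delta>(2) in auto)
  finally show thesis using that f E0 by simp
qed

section \<open>Rotation of the phase vector during a rest\<close>

text \<open>The damping \<omega> - \<epsilon> leaves an oscillation of frequency \<nu> at least
  \<epsilon>, and after time pi / \<nu> the phase vector is a negative multiple of the initial one.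
  Its cross product \<open>G\<close> with the prescribed direction has then changed sign, so it
  vanishes at some time in between.\<close>

lemma underdamped_rotation:
  assumes "0 < \<epsilon>" "\<epsilon> < \<omega>"
  obtains \<tau> h h' where "0 \<le> \<tau>" "\<tau> \<le> pi / \<epsilon>" "damped_on (\<lambda>_. \<omega> - \<epsilon>) \<omega> 0 \<tau> h h'"
    "h 0 = p" "h' 0 = q" "h' \<tau> * x = h \<tau> * y"
proof -
  define d where "d = \<omega> - \<epsilon>"
  define \<nu> where "\<nu> = sqrt (\<omega>\<^sup>2 - d\<^sup>2)"
  have "\<omega>\<^sup>2 - d\<^sup>2 - \<epsilon>\<^sup>2 = 2 * \<epsilon> * (\<omega> - \<epsilon>)"
    by (simp add: d_def power2_eq_square algebra_simps)
  moreover have "2 * \<epsilon> * (\<omega> - \<epsilon>) \<ge> 0" using assms by simp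
  ultimately have le: "\<epsilon>\<^sup>2 \<le> \<omega>\<^sup>2 - d\<^sup>2" by linarith
  then have "\<epsilon> \<le> \<nu>" unfolding \<nu>_def by (rule real_le_rsqrt)
  then have "\<nu> > 0" using assms by simp
  have \<nu>2: "\<omega>\<^sup>2 = d\<^sup>2 + \<nu>\<^sup>2"
    using order_trans[OF zero_le_power2 le] by (simp add: \<nu>_def)
  define \<beta> where "\<beta> = (q + d * p) / \<nu>"
  define h where "h t = exp (- d * t) * (p * cos (\<nu> * t) + \<beta> * sin (\<nu> * t))" for t
  define h' where "h' t = exp (- d * t) * (- d * (p * cos (\<nu> * t) + \<beta> * sin (\<nu> * t))
      + \<nu> * (\<beta> * cos (\<nu> * t) - p * sin (\<nu> * t)))" for t
  have h: "(h has_real_derivative h' t) (at t within S)" for t S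
    unfolding h_def[abs_def] h'_def
    by (rule derivative_eq_intros refl | simp)+ (simp add: algebra_simps)
  have h': "(h' has_real_derivative - 2 * d * h' t - \<omega>\<^sup>2 * h t) (at t within S)" for t S
    unfolding h'_def[abs_def] h_def \<nu>2
    by (rule derivative_eq_intros refl | simp)+ (simp add: algebra_simps power2_eq_square)
  define G where "G t = h' t * x - h t * y" for t
  have Gc: "continuous_on S G" for S
    unfolding G_def h_def h'_def by (intro continuous_intros)
  have G\<pi>: "G (pi / \<nu>) = - (exp (- d * (pi / \<nu>)) * G 0)"
    using \<open>\<nu> > 0\<close> by (simp add: G_def h_def h'_def algebra_simps)
  have "\<exists>\<tau>. 0 \<le> \<tau> \<and> \<tau> \<le> pi / \<nu> \<and> G \<tau> = 0"
  proof (cases "G 0 \<le> 0")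
    case True
    then show ?thesis using \<open>\<nu> > 0\<close>
      by (intro IVT' Gc) (auto simp: G\<pi> mult_le_0_iff)
  next
    case False
    then show ?thesis using \<open>\<nu> > 0\<close>
      by (intro IVT2' Gc) (auto simp: G\<pi>)
  qed
  then obtain \<tau> where \<tau>: "0 \<le> \<tau>" "\<tau> \<le> pi / \<nu>" "G \<tau> = 0" by blast
  have "pi / \<nu> \<le> pi / \<epsilon>"
    using \<open>\<epsilon> \<le> \<nu>\<close> assms by (intro divide_left_mono) auto
  moreover have "damped_on (\<lambda>_. \<omega> - \<epsilon>) \<omega> 0 \<tau> h h'"
    using h h' by (simp add: damped_on_def d_def)
  moreover have "h 0 = p" "h' 0 = q"
    using \<open>\<nu> > 0\<close> by (simp_all add: h_def h'_def \<beta>_def)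
  ultimately show thesis
    using that \<tau> by (simp add: G_def)
qed

section \<open>Contraction over two pulses and two rests\<close>

text \<open>The first pulse destroys the \<open>f\<close> component of \<open>u\<close>. The
  \<open>g\<close> component reaches time \<open>s\<close> as a multiple of the initial data of
  \<open>f\<close>, so the second pulse destroys it. The factor 2 is the price of adding the two
  remainders.\<close>

lemma two_pulse_contraction:
  assumes "\<omega> > 0" "0 \<le> L" "L \<le> s"
    and \<delta>: "\<And>t. 0 \<le> \<delta> t" "\<And>t. \<delta> (t + s) = \<delta> t"
    and f: "damped_on \<delta> \<omega> 0 L f f'" "energy \<omega> (f 0) (f' 0) = 1" "energy \<omega> (f L) (f' L) \<le> \<kappa>"
    and g: "damped_on \<delta> \<omega> 0 L g g'" "g 0 = - f' 0 / \<omega>" "g' 0 = \<omega> * f 0"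
    and h: "damped_on \<delta> \<omega> L s h h'" "h L = g L" "h' L = g' L" "h' s * f 0 = h s * f' 0"
    and u: "damped_on \<delta> \<omega> 0 (2 * s) u u'"
  shows "energy \<omega> (u (2 * s)) (u' (2 * s)) \<le> 2 * \<kappa> * energy \<omega> (u 0) (u' 0)"
proof -
  \<comment> \<open>\<open>\<alpha>\<close> and \<open>\<beta>\<close> are the coordinates of the
    initial data of \<open>u\<close> in the energy-orthonormal basis given by the initial data of
    \<open>f\<close> and \<open>g\<close>. Likewise \<open>\<gamma>\<close> is the coordinate of
    \<open>(h s, h' s)\<close> along \<open>f\<close>, and by the parallelism assumption it
    determines that vector.\<close>
  define \<alpha> where "\<alpha> = \<omega>\<^sup>2 * u 0 * f 0 + u' 0 * f' 0"
  define \<beta> where "\<beta> = \<omega> * (u' 0 * f 0 - u 0 * f' 0)"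
  define \<gamma> where "\<gamma> = \<omega>\<^sup>2 * h s * f 0 + h' s * f' 0"
  have f1: "f' 0 * f' 0 = 1 - \<omega>\<^sup>2 * f 0 * f 0"
    using f(2) by (simp add: power2_eq_square algebra_simps)
  have u0: "u 0 = \<alpha> * f 0 + \<beta> * g 0" "u' 0 = \<alpha> * f' 0 + \<beta> * g' 0"
    using f1 \<open>\<omega> > 0\<close> unfolding \<alpha>_def \<beta>_def g by (simp_all, algebra+)
  have E0: "energy \<omega> (u 0) (u' 0) = \<alpha>\<^sup>2 + \<beta>\<^sup>2"
    using f1 unfolding \<alpha>_def \<beta>_def by algebra
  have hs: "h s = \<gamma> * f 0" "h' s = \<gamma> * f' 0"
    using f1 h(4) unfolding \<gamma>_def by algebra+
  have "energy \<omega> (h s) (h' s) \<le> energy \<omega> (h L) (h' L)"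
    by (intro damped_on_energy_le[OF h(1)] assms)
  also have "\<dots> \<le> energy \<omega> (g 0) (g' 0)"
    unfolding h by (intro damped_on_energy_le[OF g(1)] assms)
  also have "\<dots> = 1"
    using f(2) \<open>\<omega> > 0\<close> by (simp add: g power_divide power_mult_distrib)
  also have "energy \<omega> (h s) (h' s) = \<gamma>\<^sup>2 * energy \<omega> (f 0) (f' 0)"
    unfolding hs by algebra
  finally have \<gamma>1: "\<gamma>\<^sup>2 \<le> 1" using f(2) by simp

  have fs: "damped_on \<delta> \<omega> s (s + L) (\<lambda>t. f (t - s)) (\<lambda>t. f' (t - s))"
    using damped_on_shift[OF f(1), of \<delta> s] \<delta>(2) by (simp add: add.commute)
  have u1: "damped_on \<delta> \<omega> 0 L u u'" and u2: "damped_on \<delta> \<omega> L s u u'"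
    and u3: "damped_on \<delta> \<omega> s (s + L) u u'" and u4: "damped_on \<delta> \<omega> (s + L) (2 * s) u u'"
    using assms(2,3) by (auto intro!: damped_on_subset[OF u])

  \<comment> \<open>Squared energy distance between \<open>u\<close> and \<open>b\<close> times
    another solution; by linearity it never increases.\<close>
  define e where "e = (\<lambda>b x x' t. energy \<omega> (u t - b * x t) (u' t - b * x' t))"
  have e_le: "e b x x' d \<le> e b x x' a"
    if "damped_on \<delta> \<omega> a d u u'" "damped_on \<delta> \<omega> a d x x'" "a \<le> d" for a d b x x'
    using damped_on_energy_le[OF damped_on_lincomb[OF that(1,2), of 1 "- b"] that(3) \<delta>(1)]
    by (simp add: e_def)

  text \<open>The solution \<open>u - \<alpha> f - \<beta> g\<close> has zero energy at \<open>0\<close>, hence at \<open>L\<close>.\<close>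
  have "energy \<omega> (u L - \<beta> * g L - \<alpha> * f L) (u' L - \<beta> * g' L - \<alpha> * f' L) \<le> 0"
    using damped_on_energy_le[OF damped_on_lincomb[OF
          damped_on_lincomb[OF u1 g(1), of 1 "- \<beta>"] f(1), of 1 "- \<alpha>"] \<open>0 \<le> L\<close> \<delta>(1)] u0
    by simp
  moreover have "energy \<omega> x y \<le> 0 \<Longrightarrow> x = 0 \<and> y = 0" for x y
    using \<open>\<omega> > 0\<close> sum_power2_le_zero_iff[of y "\<omega> * x"] by (auto simp: power_mult_distrib)
  ultimately have uL: "u L - \<beta> * g L = \<alpha> * f L" "u' L - \<beta> * g' L = \<alpha> * f' L"
    by fastforce+

  \<comment> \<open>What is left at \<open>s + L\<close> after removing the trace of the
    \<open>g\<close> component. Followed backwards through the second pulse and the rest, its energy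
    is bounded by that of \<open>\<alpha>\<close> times \<open>f\<close> at time \<open>L\<close>;
    the two comparisons match at \<open>s\<close> because \<open>h s\<close> is
    \<open>\<gamma> * f 0\<close>.\<close>
  define w where "w = u (s + L) - (\<beta> * \<gamma>) * f L"
  define w' where "w' = u' (s + L) - (\<beta> * \<gamma>) * f' L"
  have "energy \<omega> w w' = e (\<beta> * \<gamma>) (\<lambda>t. f (t - s)) (\<lambda>t. f' (t - s)) (s + L)"
    by (simp add: e_def w_def w'_def)
  also have "\<dots> \<le> e (\<beta> * \<gamma>) (\<lambda>t. f (t - s)) (\<lambda>t. f' (t - s)) s"
    using \<open>0 \<le> L\<close> by (intro e_le u3 fs) simp
  also have "\<dots> = e \<beta> h h' s"
    by (simp add: e_def hs mult.assoc)
  also have "\<dots> \<le> e \<beta> h h' L"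
    by (intro e_le u2 h(1) assms)
  also have "\<dots> = \<alpha>\<^sup>2 * energy \<omega> (f L) (f' L)"
    by (simp add: e_def h uL power_mult_distrib algebra_simps)
  also have "\<dots> \<le> \<alpha>\<^sup>2 * \<kappa>"
    by (intro mult_left_mono f(3)) simp
  finally have w: "energy \<omega> w w' \<le> \<alpha>\<^sup>2 * \<kappa>" .

  have "energy \<omega> ((\<beta> * \<gamma>) * f L) ((\<beta> * \<gamma>) * f' L) = \<beta>\<^sup>2 * \<gamma>\<^sup>2 * energy \<omega> (f L) (f' L)"
    by (simp add: power_mult_distrib algebra_simps)
  also have "\<dots> \<le> \<beta>\<^sup>2 * 1 * \<kappa>"
    using f(3) \<gamma>1 by (intro mult_mono mult_left_mono) auto
  finally have z: "energy \<omega> ((\<beta> * \<gamma>) * f L) ((\<beta> * \<gamma>) * f' L) \<le> \<beta>\<^sup>2 * \<kappa>" by simp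

  have par: "energy \<omega> (x + y) (x' + y') \<le> 2 * energy \<omega> x x' + 2 * energy \<omega> y y'" for x y x' y'
  proof -
    have "2 * energy \<omega> x x' + 2 * energy \<omega> y y' - energy \<omega> (x + y) (x' + y')
        = energy \<omega> (x - y) (x' - y')" by algebra
    then show ?thesis by (smt (verit) mult_nonneg_nonneg zero_le_power2)
  qed
  have "energy \<omega> (u (2 * s)) (u' (2 * s)) \<le> energy \<omega> (u (s + L)) (u' (s + L))"
    using \<open>L \<le> s\<close> by (intro damped_on_energy_le[OF u4] \<delta>(1)) simp
  also have "\<dots> = energy \<omega> (w + (\<beta> * \<gamma>) * f L) (w' + (\<beta> * \<gamma>) * f' L)"
    by (simp add: w_def w'_def)
  also have "\<dots> \<le> 2 * (\<alpha>\<^sup>2 * \<kappa>) + 2 * (\<beta>\<^sup>2 * \<kappa>)"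
    by (rule order_trans[OF par add_mono[OF mult_left_mono[OF w] mult_left_mono[OF z]]])
      simp_all
  also have "\<dots> = 2 * \<kappa> * energy \<omega> (u 0) (u' 0)"
    unfolding E0 by (simp add: algebra_simps)
  finally show ?thesis .
qed

section \<open>The periodic pulse shape\<close>

text \<open>The distance to the union of all rests is 1-Lipschitz and inherits periodicity from that
  set. Inside the first pulse the nearest rest points are \<open>0\<close> and \<open>L\<close>,
  which gives the tent.\<close>

lemma periodic_tent:
  fixes L s :: real
  assumes "0 < L" "L \<le> s"
  obtains \<phi> :: "real \<Rightarrow> real" where "\<And>t. 0 \<le> \<phi> t" "\<And>t. \<phi> (t + s) = \<phi> t"
    "\<And>t r. \<bar>\<phi> t - \<phi> r\<bar> \<le> \<bar>t - r\<bar>" "\<And>t. t \<in> {0..L} \<Longrightarrow> \<phi> t = min t (L - t)"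
    "\<And>t. t \<in> {L..s} \<Longrightarrow> \<phi> t = 0"
proof -
  \<comment> \<open>The rests for all integers \<open>k\<close>. For \<open>L = s\<close> they
    shrink to the multiples of \<open>s\<close>, so a rest of length zero is covered. The index
    \<open>-1\<close> provides the point \<open>0\<close>.\<close>
  define Z where "Z = {x. \<exists>k::int. of_int k * s + L \<le> x \<and> x \<le> (of_int k + 1) * s}"
  have Zt: "(\<lambda>x. x + s) ` Z = Z"
  proof (intro equalityI subsetI)
    fix x assume "x \<in> (\<lambda>x. x + s) ` Z"
    then obtain k :: int where "of_int k * s + L \<le> x - s" "x - s \<le> (of_int k + 1) * s"
      by (auto simp: Z_def)
    then show "x \<in> Z"
      unfolding Z_def by (intro CollectI exI[of _ "k + 1"]) (simp add: algebra_simps)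
  next
    fix x assume "x \<in> Z"
    then obtain k :: int where "of_int k * s + L \<le> x" "x \<le> (of_int k + 1) * s"
      by (auto simp: Z_def)
    then have "x - s \<in> Z"
      unfolding Z_def by (intro CollectI exI[of _ "k - 1"]) (simp add: algebra_simps)
    then show "x \<in> (\<lambda>x. x + s) ` Z" by (intro image_eqI[of _ _ "x - s"]) auto
  qed
  have LZ: "{L..s} \<subseteq> Z" unfolding Z_def by (auto intro!: exI[of _ 0])
  then have "L \<in> Z" using assms by auto
  have "0 \<in> Z" unfolding Z_def using assms by (auto intro!: exI[of _ "-1"])
  have out: "z \<le> 0 \<or> L \<le> z" if "z \<in> Z" for z
  proof -
    obtain k :: int where k: "of_int k * s + L \<le> z" "z \<le> (of_int k + 1) * s"
      using \<open>z \<in> Z\<close> by (auto simp: Z_def)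
    show ?thesis
    proof (cases "0 \<le> k")
      case True
      then have "0 \<le> of_int k * s" using assms by simp
      then show ?thesis using k by linarith
    next
      case False
      then have "(of_int k + 1) * s \<le> 0"
        using assms by (intro mult_nonpos_nonneg) auto
      then show ?thesis using k by linarith
    qed
  qed
  show thesis
  proof (rule that[of "\<lambda>t. infdist t Z"])
    show "infdist (t + s) Z = infdist t Z" for t
    proof -
      have "infdist (t + s) ((\<lambda>x. x + s) ` Z) = infdist t Z"
        using \<open>0 \<in> Z\<close> by (auto simp: infdist_def image_image dist_real_def)
      then show ?thesis by (simp add: Zt)
    qed
    show "\<bar>infdist t Z - infdist r Z\<bar> \<le> \<bar>t - r\<bar>" for t r
      using infdist_triangle_abs[of t Z r] by (simp add: dist_real_def)
    show "infdist t Z = 0" if "t \<in> {L..s}" for t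
      using that LZ by auto
    fix t assume t: "t \<in> {0..L}"
    show "infdist t Z = min t (L - t)"
    proof (rule antisym)
      show "infdist t Z \<le> min t (L - t)"
        using infdist_le[OF \<open>0 \<in> Z\<close>, of t] infdist_le[OF \<open>L \<in> Z\<close>, of t] t
        by (simp add: dist_real_def)
      have "min t (L - t) \<le> dist t z" if "z \<in> Z" for z
        using out[OF that] t by (auto simp: dist_real_def)
      then show "min t (L - t) \<le> infdist t Z"
        using \<open>0 \<in> Z\<close> by (auto simp: infdist_def intro!: cINF_greatest)
    qed
  qed (simp add: infdist_nonneg)
qed

section \<open>From contraction over one period to exponential decay on the half-line\<close>

lemma damped_solution_imp_damped_on:
  assumes "damped_solution \<delta> \<omega> u u'" "0 \<le> a"
  shows "damped_on \<delta> \<omega> a b u u'"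
proof -
  obtain u'' where u'': "\<And>t. t \<ge> 0 \<Longrightarrow> (u has_real_derivative u' t) (at t within {0..}) \<and>
      (u' has_real_derivative u'' t) (at t within {0..}) \<and>
      u'' t + 2 * \<delta> t * u' t + \<omega>\<^sup>2 * u t = 0"
    using assms(1) unfolding damped_solution_def by auto
  have sub: "{a..b} \<subseteq> {0..}" using assms(2) by auto
  show ?thesis
    unfolding damped_on_def
  proof (intro ballI conjI)
    fix t assume "t \<in> {a..b}"
    then have "t \<ge> 0" using assms(2) by auto
    note t = u''[OF this]
    have u''_eq: "- 2 * \<delta> t * u' t - \<omega>\<^sup>2 * u t = u'' t" using t by linarith
    show "(u has_real_derivative u' t) (at t within {a..b})"
      "(u' has_real_derivative - 2 * \<delta> t * u' t - \<omega>\<^sup>2 * u t) (at t within {a..b})"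
      unfolding u''_eq using t DERIV_subset[OF _ sub] by blast+
  qed
qed

text \<open>The contraction is iterated over the complete periods before \<open>t\<close>, and the
  energy does not grow in the incomplete one. Less than one period is lost, hence
  \<open>t - T\<close> in the exponent.\<close>

lemma damped_solution_exp_decay:
  assumes "T > 0" "R > 0" and \<delta>: "\<And>t. 0 \<le> \<delta> t" "\<And>t. \<delta> (t + T) = \<delta> t"
    and contr: "\<And>u u'. damped_on \<delta> \<omega> 0 T u u' \<Longrightarrow>
      energy \<omega> (u T) (u' T) \<le> exp (- R * T) * energy \<omega> (u 0) (u' 0)"
    and u: "damped_solution \<delta> \<omega> u u'" and "t \<ge> 0"
  shows "energy \<omega> (u t) (u' t) \<le> energy \<omega> (u 0) (u' 0) * exp (- R * max (t - T) 0)"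
proof -
  \<comment> \<open>The shift is negative because solutions on later periods are moved back to start
    at \<open>0\<close>.\<close>
  have per: "\<delta> (t + - (real k * T)) = \<delta> t" for k t
  proof (induction k)
    case (Suc k)
    then show ?case
      using \<delta>(2)[of "t + - (real (Suc k) * T)"] by (simp add: algebra_simps)
  qed simp
  have iter: "energy \<omega> (u (real k * T)) (u' (real k * T))
      \<le> exp (- R * (real k * T)) * energy \<omega> (u 0) (u' 0)" for k
  proof (induction k)
    case (Suc k)
    let ?a = "real k * T"
    have "damped_on \<delta> \<omega> ?a (?a + T) u u'"
      by (rule damped_solution_imp_damped_on[OF u]) (use \<open>T > 0\<close> in simp)
    from damped_on_shift[OF this, of \<delta> "- ?a"]
    have "damped_on \<delta> \<omega> 0 T (\<lambda>t. u (t + ?a)) (\<lambda>t. u' (t + ?a))"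
      using per by simp
    from contr[OF this]
    have "energy \<omega> (u (T + ?a)) (u' (T + ?a)) \<le> exp (- R * T) * energy \<omega> (u ?a) (u' ?a)"
      by simp
    also have "\<dots> \<le> exp (- R * T) * (exp (- R * ?a) * energy \<omega> (u 0) (u' 0))"
      by (intro mult_left_mono Suc) simp
    also have "\<dots> = exp (- R * (real (Suc k) * T)) * energy \<omega> (u 0) (u' 0)"
      by (simp only: mult.assoc[symmetric] exp_add[symmetric]) (simp add: algebra_simps)
    finally show ?case
      by (simp add: algebra_simps)
  qed simp
  define k where "k = nat \<lfloor>t / T\<rfloor>"
  have k: "real k \<le> t / T" "t / T < real k + 1"
    using \<open>t \<ge> 0\<close> \<open>T > 0\<close> by (auto simp: k_def)
  then have kt: "real k * T \<le> t" "t - T \<le> real k * T" "0 \<le> real k * T"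
    using \<open>T > 0\<close> by (auto simp: field_simps)
  have "energy \<omega> (u t) (u' t) \<le> energy \<omega> (u (real k * T)) (u' (real k * T))"
    by (rule damped_on_energy_le[OF damped_solution_imp_damped_on[OF u]]) (use kt \<delta> in auto)
  also have "\<dots> \<le> exp (- R * (real k * T)) * energy \<omega> (u 0) (u' 0)" by (rule iter)
  also have "\<dots> \<le> exp (- R * max (t - T) 0) * energy \<omega> (u 0) (u' 0)"
    using kt \<open>R > 0\<close> by (intro mult_right_mono) auto
  finally show ?thesis by (simp add: mult.commute)
qed

section \<open>Numerical estimates for the period\<close>

lemma ln_2_ge_half: "1 / 2 \<le> ln (2 :: real)"
  using ln_le_minus_one[of "1 / 2 :: real"] by (simp add: ln_div)

text \<open>The left-hand side is \<open>R\<close> times the maximal period, the right-hand side the guaranteed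
  logarithmic energy loss per period.\<close>
lemma pulse_length_suffices:
  fixes \<omega> R \<epsilon> n :: real
  assumes "\<omega> > 0" "R > 0" "\<epsilon> > 0"
    and n: "n = 4 * (pi / \<epsilon> + 1) * R + 1 / (2 * \<epsilon>) + 2 / \<omega> + 1 / 2"
  shows "R * (4 * (n + 1) + 2 * pi / \<epsilon>) \<le> 2 * (\<omega> + \<epsilon> * n) * n - ln 2"
proof -
  have pi: "3 < pi" "pi < 4" using pi_gt3 pi_less_4 by auto
  have p: "0 \<le> R * pi / \<epsilon>" "0 \<le> 1 / \<epsilon>" "0 \<le> 1 / \<omega>" using assms pi by auto
  \<comment> \<open>Each part of \<open>n\<close> serves one estimate: \<open>2 / \<omega>\<close>
    makes the linear term absorb \<open>ln 2\<close>, \<open>1 / (2 * \<epsilon>) + 1 / 2\<close>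
    bounds the period by \<open>24 * n\<close>, and the multiple of \<open>R\<close> lets the
    quadratic term absorb \<open>24 * R * n\<close>.\<close>
  have "n \<ge> 2 / \<omega>" using p assms by (simp add: algebra_simps)
  then have "\<omega> * n \<ge> 2" using \<open>\<omega> > 0\<close> by (simp add: field_simps)
  have n1: "n \<ge> 1 / 2 + 1 / (2 * \<epsilon>)" using p assms by (simp add: algebra_simps)
  have "n \<ge> 1 / 2" using order_trans[OF _ n1, of "1 / 2"] \<open>\<epsilon> > 0\<close> by simp
  have "n \<ge> 4 * pi / \<epsilon> * R" using p assms by (simp add: algebra_simps)
  then have "\<epsilon> * n \<ge> 4 * pi * R" using \<open>\<epsilon> > 0\<close> by (simp add: field_simps)
  moreover have "4 * pi * R \<ge> 12 * R" using pi \<open>R > 0\<close> by simp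
  ultimately have "\<epsilon> * n \<ge> 12 * R" by linarith
  then have "\<epsilon> * n * n \<ge> 12 * R * n" using \<open>n \<ge> 1 / 2\<close> by (intro mult_right_mono) auto
  moreover have "R * (4 * (n + 1) + 2 * pi / \<epsilon>) \<le> R * (24 * n)"
  proof (rule mult_left_mono)
    have "4 * (n + 1) + 2 * pi / \<epsilon> \<le> 4 * (n + 1) + 10 / \<epsilon>"
      using pi \<open>\<epsilon> > 0\<close> by (simp add: divide_right_mono)
    also have "10 / \<epsilon> \<le> 20 * n - 10" using n1 by (simp add: field_simps)
    finally show "4 * (n + 1) + 2 * pi / \<epsilon> \<le> 24 * n" using \<open>n \<ge> 1 / 2\<close> by simp
  qed (use \<open>R > 0\<close> in simp)
  moreover have "ln 2 \<le> (1 :: real)" using ln_le_minus_one[of 2] by simp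
  ultimately show ?thesis using \<open>\<omega> * n \<ge> 2\<close> by (simp add: algebra_simps)
qed

section \<open>Construction of the damping and choice of the period\<close>

theorem theorem2p8:
  fixes \<omega> R \<epsilon> :: real
  assumes "\<omega> > 0" and "R > 0" and "0 < \<epsilon>" and "\<epsilon> < \<omega>"
  shows "\<exists>t\<^sub>0 > 0.
    t\<^sub>0 \<le> 16 * (pi / \<epsilon> + 1) * R + 2 * (pi + 1) / \<epsilon> + 8 / \<omega> + 2 + 8 * ln 2 \<and>
    (\<exists>\<delta> :: real \<Rightarrow> real.
      (\<forall>t\<ge>0. \<delta> t \<ge> 0) \<and>
      (\<forall>t\<ge>0. \<delta> (t + t\<^sub>0) = \<delta> t) \<and>
      (\<forall>t\<ge>0. \<forall>s\<ge>0. \<bar>\<delta> t - \<delta> s\<bar> \<le> \<epsilon> * \<bar>t - s\<bar>) \<and>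
      (\<forall>t\<ge>0. \<delta> t \<ge> \<omega> - \<epsilon>) \<and>
      (\<forall>u u'. damped_solution \<delta> \<omega> u u' \<longrightarrow>
        (\<forall>t\<ge>0. \<bar>u' t\<bar>\<^sup>2 + \<omega>\<^sup>2 * \<bar>u t\<bar>\<^sup>2
               \<le> (\<bar>u' 0\<bar>\<^sup>2 + \<omega>\<^sup>2 * \<bar>u 0\<bar>\<^sup>2) * exp (- R * max (t - t\<^sub>0) 0))))"
proof -
  define n where "n = 4 * (pi / \<epsilon> + 1) * R + 1 / (2 * \<epsilon>) + 2 / \<omega> + 1 / 2"
  have "n > 0" unfolding n_def using assms by (intro add_pos_pos mult_pos_pos) auto
  \<comment> \<open>The damping climbs with slope \<epsilon> from \<omega> - \<epsilon> to \<omega>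
    in time 1, then to \<omega> + \<epsilon> n at the midpoint.\<close>
  define L where "L = 2 * (n + 1)"
  have "L > 0" using \<open>n > 0\<close> by (simp add: L_def)
  \<comment> \<open>A single pulse is fixed before the full damping, because the length of the rest,
    and with it the period, depends on solutions over this pulse.\<close>
  define p where "p t = \<omega> - \<epsilon> + \<epsilon> * min t (L - t)" for t
  have pc: "continuous_on S p" for S
    unfolding p_def by (intro continuous_intros)
  have p0: "0 \<le> p t" if "t \<in> {0..L}" for t
    using that assms by (auto simp: p_def intro!: add_nonneg_nonneg)

  \<comment> \<open>The damping at time \<open>n / 2 + 1\<close> from either end of the pulse, which
    leaves a middle part of length \<open>n\<close>. Cutting at height \<epsilon> x above \<omega>
    gives an exponent with quadratic part 8 \<epsilon> x (n - x), largest at x = n / 2.\<close>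
  define c where "c = \<omega> + \<epsilon> * n / 2"
  define \<kappa> where "\<kappa> = exp (- 2 * (2 * c - \<omega>) * n)"
  obtain f f' where f: "damped_on p \<omega> 0 L f f'" "energy \<omega> (f 0) (f' 0) = 1"
    "energy \<omega> (f L) (f' L) \<le> \<kappa>"
  proof (rule damped_on_fast_solution[OF \<open>\<omega> > 0\<close> pc p0, of L "n / 2 + 1" "3 * n / 2 + 1" c])
    show "c \<le> p t" if "t \<in> {n / 2 + 1..3 * n / 2 + 1}" for t
    proof -
      have "n / 2 + 1 \<le> min t (L - t)" using that by (auto simp: L_def)
      from mult_left_mono[OF this, of \<epsilon>] show ?thesis
        using assms by (simp add: c_def p_def algebra_simps)
    qed
  qed (use \<open>n > 0\<close> assms in \<open>auto simp: L_def c_def \<kappa>_def\<close>)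
  obtain g g' where g: "damped_on p \<omega> 0 L g g'" "g 0 = - f' 0 / \<omega>" "g' 0 = \<omega> * f 0"
    using damped_on_exists[OF less_imp_le[OF \<open>L > 0\<close>] pc] .
  obtain \<tau> h h' where \<tau>: "0 \<le> \<tau>" "\<tau> \<le> pi / \<epsilon>"
    and h: "damped_on (\<lambda>_. \<omega> - \<epsilon>) \<omega> 0 \<tau> h h'" "h 0 = g L" "h' 0 = g' L"
      "h' \<tau> * f 0 = h \<tau> * f' 0"
    using underdamped_rotation[OF \<open>0 < \<epsilon>\<close> \<open>\<epsilon> < \<omega>\<close>] .

  define s where "s = L + \<tau>"
  have "L \<le> s" using \<tau> by (simp add: s_def)
  obtain \<phi> where \<phi>: "\<And>t. 0 \<le> \<phi> t" "\<And>t. \<phi> (t + s) = \<phi> t"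
    "\<And>t r. \<bar>\<phi> t - \<phi> r\<bar> \<le> \<bar>t - r\<bar>" "\<And>t. t \<in> {0..L} \<Longrightarrow> \<phi> t = min t (L - t)"
    "\<And>t. t \<in> {L..s} \<Longrightarrow> \<phi> t = 0"
    using periodic_tent[OF \<open>L > 0\<close> \<open>L \<le> s\<close>] by blast
  define \<delta> where "\<delta> t = \<omega> - \<epsilon> + \<epsilon> * \<phi> t" for t
  have \<delta>s: "\<delta> (t + s) = \<delta> t" for t by (simp add: \<delta>_def \<phi>)
  have \<delta>_ge: "\<omega> - \<epsilon> \<le> \<delta> t" for t using \<phi>(1) assms by (simp add: \<delta>_def)
  then have \<delta>0: "0 \<le> \<delta> t" for t using assms by (smt (verit))
  \<comment> \<open>The form \<open>t + 0\<close> matches \<open>damped_on_shift\<close> with zero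
    shift.\<close>
  have \<delta>p: "\<delta> (t + 0) = p t" if "t \<in> {0..L}" for t
    using \<phi>(4)[OF that] by (simp add: \<delta>_def p_def)
  have f\<delta>: "damped_on \<delta> \<omega> 0 L f f'" and g\<delta>: "damped_on \<delta> \<omega> 0 L g g'"
    using damped_on_shift[OF f(1) \<delta>p] damped_on_shift[OF g(1) \<delta>p] by simp_all
  have h\<delta>: "damped_on \<delta> \<omega> L s (\<lambda>t. h (t - L)) (\<lambda>t. h' (t - L))"
    using damped_on_shift[OF h(1), of \<delta> L] \<phi>(5) by (simp add: \<delta>_def s_def add.commute)

  define t\<^sub>0 where "t\<^sub>0 = 2 * s"
  have t0: "t\<^sub>0 \<le> 4 * (n + 1) + 2 * pi / \<epsilon>"
    using \<tau> by (simp add: t\<^sub>0_def s_def L_def)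
  have "- 2 * (2 * c - \<omega>) * n = - (2 * (\<omega> + \<epsilon> * n) * n)"
    by (simp add: c_def algebra_simps)
  then have "2 * \<kappa> = exp (ln 2 - 2 * (\<omega> + \<epsilon> * n) * n)"
    unfolding \<kappa>_def by (simp add: exp_diff exp_minus divide_inverse)
  also have "\<dots> \<le> exp (- R * t\<^sub>0)"
    using order_trans[OF mult_left_mono[OF t0 less_imp_le[OF \<open>R > 0\<close>]]
        pulse_length_suffices[OF \<open>\<omega> > 0\<close> \<open>R > 0\<close> \<open>0 < \<epsilon>\<close> n_def]] by simp
  finally have \<kappa>: "2 * \<kappa> \<le> exp (- R * t\<^sub>0)" .
  have contr: "energy \<omega> (u t\<^sub>0) (u' t\<^sub>0) \<le> exp (- R * t\<^sub>0) * energy \<omega> (u 0) (u' 0)"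
    if "damped_on \<delta> \<omega> 0 t\<^sub>0 u u'" for u u'
  proof -
    have "energy \<omega> (u t\<^sub>0) (u' t\<^sub>0) \<le> 2 * \<kappa> * energy \<omega> (u 0) (u' 0)"
      using that unfolding t\<^sub>0_def
      by (intro two_pulse_contraction[OF \<open>\<omega> > 0\<close> less_imp_le[OF \<open>L > 0\<close>] \<open>L \<le> s\<close> \<delta>0 \<delta>s
            f\<delta> f(2,3) g\<delta> g(2,3) h\<delta>]) (use h in \<open>auto simp: s_def\<close>)
    also have "\<dots> \<le> exp (- R * t\<^sub>0) * energy \<omega> (u 0) (u' 0)"
      by (intro mult_right_mono \<kappa>) simp
    finally show ?thesis .
  qed
  have "t\<^sub>0 > 0" using \<open>L > 0\<close> \<open>L \<le> s\<close> by (simp add: t\<^sub>0_def)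
  have \<delta>t: "\<delta> (t + t\<^sub>0) = \<delta> t" for t
    using \<delta>s[of t] \<delta>s[of "t + s"] by (simp add: t\<^sub>0_def algebra_simps)
  have lip: "\<bar>\<delta> t - \<delta> r\<bar> \<le> \<epsilon> * \<bar>t - r\<bar>" for t r
  proof -
    have "\<bar>\<delta> t - \<delta> r\<bar> = \<epsilon> * \<bar>\<phi> t - \<phi> r\<bar>"
      using \<open>0 < \<epsilon>\<close> by (simp add: \<delta>_def abs_mult flip: right_diff_distrib)
    also have "\<dots> \<le> \<epsilon> * \<bar>t - r\<bar>" using \<open>0 < \<epsilon>\<close> \<phi>(3) by (intro mult_left_mono) auto
    finally show ?thesis .
  qed
  \<comment> \<open>The remaining constant 6 is at most 2 + 8 log 2, since log 2 is at least
    1/2.\<close>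
  have "4 * (n + 1) + 2 * pi / \<epsilon>
      = 16 * (pi / \<epsilon> + 1) * R + 2 * (pi + 1) / \<epsilon> + 8 / \<omega> + 6"
    by (simp add: n_def add_divide_distrib algebra_simps)
  then have "t\<^sub>0 \<le> 16 * (pi / \<epsilon> + 1) * R + 2 * (pi + 1) / \<epsilon> + 8 / \<omega> + 2 + 8 * ln 2"
    using t0 ln_2_ge_half by linarith
  moreover have "\<forall>u u'. damped_solution \<delta> \<omega> u u' \<longrightarrow> (\<forall>t\<ge>0. \<bar>u' t\<bar>\<^sup>2 + \<omega>\<^sup>2 * \<bar>u t\<bar>\<^sup>2
      \<le> (\<bar>u' 0\<bar>\<^sup>2 + \<omega>\<^sup>2 * \<bar>u 0\<bar>\<^sup>2) * exp (- R * max (t - t\<^sub>0) 0))"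
    unfolding power2_abs
    by (intro allI impI damped_solution_exp_decay[where \<delta> = \<delta>, OF \<open>t\<^sub>0 > 0\<close> \<open>R > 0\<close> \<delta>0 \<delta>t])
      (erule contr)
  ultimately show ?thesis
    using \<open>t\<^sub>0 > 0\<close> \<delta>0 \<delta>t lip \<delta>_ge by blast
qed

end
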